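(* Let $\mathbb{D}$ be an $\mathbb{F}_1$-composable class of filters, let $(X,\xi)$ and $(Y,\tau)$ be convergence spaces with $\tau=\mathrm{Adh}_{\mathbb{D}}\tau$, and let $f:(X,\xi)\to(Y,\tau)$ be a map. The following are equivalent: (1) $f$ is continuous; (2) $f$ is a compact relation; (3) $f$ is a $\mathbb{D}$-compact relation.
   Context: Filters and classes. For filters, $\mathcal{F}\leq\mathcal{G}$ means $\mathcal{F}\subset\mathcal{G}$. Families $\mathcal{A},\mathcal{B}$ of subsets of a set mesh, $\mathcal{A}\#\mathcal{B}$, if $A\cap B\neq\emptyset$ for all $A\in\mathcal{A}$, $B\in\mathcal{B}$. $\mathcal{A}^{\uparrow}$ is the family of supersets of members of $\mathcal{A}$. A class of filters $\mathbb{D}$ assigns to each set $X$ a collection $\mathbb{D}(X)$ of filters on $X$; by convention every class contains the degenerate filter $2^X$. $\mathbb{F}$ is the class of all filters and $\mathbb{F}_1$ the class of principal filters. $\mathbb{D}$ is $\mathbb{F}_1$-composable if for all sets $X,Y$, every $\mathcal{F}\in\mathbb{D}(X)$ and every $H\subset X\times Y$, the (possibly degenerate) filter generated by $\{HF:F\in\mathcal{F}\}$ is in $\mathbb{D}(Y)$, where $HF=\{y:\exists x\in F,\ (x,y)\in H\}$. Convergence spaces. A convergence $\xi$ on $X$ is a relation between (proper) filters on $X$ and points of $X$, written $x\in\lim_\xi\mathcal{F}$, such that $\mathcal{F}\leq\mathcal{G}$ implies $\lim_\xi\mathcal{F}\subset\lim_\xi\mathcal{G}$; $x\in\lim_\xi\{x\}^{\uparrow}$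 for all $x$; and $\lim_\xi(\mathcal{F}\wedge\mathcal{G})=\lim_\xi\mathcal{F}\cap\lim_\xi\mathcal{G}$, where $\mathcal{F}\wedge\mathcal{G}=\mathcal{F}\cap\mathcal{G}$. A map $f:(X,\xi)\to(Y,\tau)$ is continuous if $f(\lim_\xi\mathcal{F})\subset\lim_\tau f(\mathcal{F})$ for all $\mathcal{F}$. $\mathrm{adh}_\xi\mathcal{F}=\bigcup_{\mathcal{G}\#\mathcal{F}}\lim_\xi\mathcal{G}$, and $\lim_{\mathrm{Adh}_{\mathbb{D}}\xi}\mathcal{F}=\bigcap\{\mathrm{adh}_\xi\mathcal{D}:\mathcal{D}\in\mathbb{D}(X),\ \mathcal{D}\#\mathcal{F}\}$. Compactness. A filter $\mathcal{F}$ is $\mathbb{D}$-compact at $A\subset X$ (for $\xi$) if $\mathcal{D}\in\mathbb{D}(X)$, $\mathcal{D}\#\mathcal{F}$ imply $\mathrm{adh}_\xi\mathcal{D}\cap A\neq\emptyset$. A relation $R:(X,\xi)\rightrightarrows(Y,\tau)$ is $\mathbb{D}$-compact if for every $A\subset X$ and every filter $\mathcal{F}$ that is $\mathbb{D}$-compact at $A$ for $\xi$, the filter $R\mathcal{F}$ generated by $\{RF:F\in\mathcal{F}\}$ is $\mathbb{D}$-compact at $RA$ for $\tau$. "Compact" means $\mathbb{F}$-compact. A map is regarded as a relation. *)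

theory Defs
  imports Complex_Main "HOL-Library.FuncSet"
begin

(* Sets X, Y, ... range over the subsets of one arbitrary type 'a, so that a class of filters can
   be a single object assigning filters to every set.  A filter on X is a library filter that
   contains X; its trace on X is the corresponding family of subsets of X.  The library orders
   filters by reverse inclusion: bot is the degenerate filter, and sup is the
   intersection of two filters. *)

definition filters_on :: "'a set \<Rightarrow> 'a filter set" where
  "filters_on X = {F. F \<le> principal X}"

definition proper_filters_on :: "'a set \<Rightarrow> 'a filter set" where
  "proper_filters_on X = {F \<in> filters_on X. F \<noteq> bot}"

definition members :: "'a filter \<Rightarrow> 'a set set" where
  "members F = {A. eventually (\<lambda>x. x \<in> A) F}"

definition mesh :: "'a filter \<Rightarrow> 'a filter \<Rightarrow> bool"  (infix "##" 50) where
  "F ## G \<longleftrightarrow> (\<forall>A \<in> members F. \<forall>B \<in> members G. A \<inter> B \<noteq> {})"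

(* The filter generated by the images H `` A of the members A of F. *)
definition rel_image :: "('a \<times> 'b) set \<Rightarrow> 'a filter \<Rightarrow> 'b filter" where
  "rel_image H F = (INF A \<in> members F. principal (H `` A))"

definition filter_class :: "('a set \<Rightarrow> 'a filter set) \<Rightarrow> bool" where
  "filter_class \<D> \<longleftrightarrow> (\<forall>X. \<D> X \<subseteq> filters_on X \<and> bot \<in> \<D> X)"

definition F1_composable :: "('a set \<Rightarrow> 'a filter set) \<Rightarrow> bool" where
  "F1_composable \<D> \<longleftrightarrow>
     (\<forall>X Y. \<forall>F \<in> \<D> X. \<forall>H. H \<subseteq> X \<times> Y \<longrightarrow> rel_image H F \<in> \<D> Y)"

type_synonym 'a convergence = "('a filter \<times> 'a) set"

definition conv_lim :: "'a convergence \<Rightarrow> 'a filter \<Rightarrow> 'a set" where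
  "conv_lim \<xi> F = {x. (F, x) \<in> \<xi>}"

definition convergence_space :: "'a set \<Rightarrow> 'a convergence \<Rightarrow> bool" where
  "convergence_space X \<xi> \<longleftrightarrow>
     \<xi> \<subseteq> proper_filters_on X \<times> X \<and>
     (\<forall>F \<in> proper_filters_on X. \<forall>G \<in> proper_filters_on X.
        members F \<subseteq> members G \<longrightarrow> conv_lim \<xi> F \<subseteq> conv_lim \<xi> G) \<and>
     (\<forall>x \<in> X. x \<in> conv_lim \<xi> (principal {x})) \<and>
     (\<forall>F \<in> proper_filters_on X. \<forall>G \<in> proper_filters_on X.
        conv_lim \<xi> (sup F G) = conv_lim \<xi> F \<inter> conv_lim \<xi> G)"

definition conv_continuous ::
    "'a set \<Rightarrow> 'a convergence \<Rightarrow> 'b convergence \<Rightarrow> ('a \<Rightarrow> 'b) \<Rightarrow> bool" where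
  "conv_continuous X \<xi> \<tau> f \<longleftrightarrow>
     (\<forall>F \<in> proper_filters_on X. f ` conv_lim \<xi> F \<subseteq> conv_lim \<tau> (filtermap f F))"

definition adh :: "'a set \<Rightarrow> 'a convergence \<Rightarrow> 'a filter \<Rightarrow> 'a set" where
  "adh X \<xi> F = (\<Union>G \<in> {G \<in> proper_filters_on X. G ## F}. conv_lim \<xi> G)"

(* The condition x \<in> X matters when no D in the class meshes with F: the empty intersection
   is X. *)
definition Adh :: "('a set \<Rightarrow> 'a filter set) \<Rightarrow> 'a set \<Rightarrow> 'a convergence \<Rightarrow> 'a convergence" where
  "Adh \<D> X \<xi> =
     {(F, x). F \<in> proper_filters_on X \<and> x \<in> X \<and> (\<forall>D \<in> \<D> X. D ## F \<longrightarrow> x \<in> adh X \<xi> D)}"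

definition compact_at ::
    "('a set \<Rightarrow> 'a filter set) \<Rightarrow> 'a set \<Rightarrow> 'a convergence \<Rightarrow> 'a filter \<Rightarrow> 'a set \<Rightarrow> bool" where
  "compact_at \<D> X \<xi> F A \<longleftrightarrow> (\<forall>D \<in> \<D> X. D ## F \<longrightarrow> adh X \<xi> D \<inter> A \<noteq> {})"

definition compact_relation ::
    "('a set \<Rightarrow> 'a filter set) \<Rightarrow> 'a set \<Rightarrow> 'a convergence \<Rightarrow> 'a set \<Rightarrow> 'a convergence
     \<Rightarrow> ('a \<times> 'a) set \<Rightarrow> bool" where
  "compact_relation \<D> X \<xi> Y \<tau> R \<longleftrightarrow>
     (\<forall>A \<subseteq> X. \<forall>F \<in> filters_on X.
        compact_at \<D> X \<xi> F A \<longrightarrow> compact_at \<D> Y \<tau> (rel_image R F) (R `` A))"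

definition map_graph :: "'a set \<Rightarrow> ('a \<Rightarrow> 'b) \<Rightarrow> ('a \<times> 'b) set" where
  "map_graph X f = {(x, f x) |x. x \<in> X}"

end

theory Submission imports Defs begin

text \<open>The graph of \<open>f\<close> moves meshing across: \<open>D\<close> meshes with \<open>f(F)\<close> iff \<open>f\<^sup>-\<^sup>1(D)\<close>
  meshes with \<open>F\<close>, and \<open>f\<^sup>-\<^sup>1(D)\<close> stays in the class by composability. So a
  continuous \<open>f\<close> maps an adherence point of \<open>f\<^sup>-\<^sup>1(D)\<close> to one of \<open>D\<close>. Conversely, if \<open>F\<close> converges
  to \<open>x\<close>, then \<open>F\<close> is compact at \<open>{x}\<close>, so \<open>f(F)\<close> is compact at \<open>{f x}\<close>, which says that
  \<open>f(F)\<close> converges to \<open>f x\<close> in \<open>Adh\<close>.\<close>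

lemma mesh_sym: "F ## G \<longleftrightarrow> G ## F"
  unfolding mesh_def by (metis Int_commute)

text \<open>The images form a filter base: \<open>H\<close> maps \<open>A \<inter> B\<close> into
  the intersection of the images of \<open>A\<close> and \<open>B\<close>. The infimum is therefore
  directed, and a single \<open>A\<close> suffices for each member.\<close>

lemma members_rel_image: "B \<in> members (rel_image H F) \<longleftrightarrow> (\<exists>A \<in> members F. H `` A \<subseteq> B)"
proof -
  have "members F \<noteq> {}"
    by (auto simp: members_def intro!: exI[of _ UNIV])
  moreover have "\<exists>C \<in> members F. principal (H `` C) \<le> inf (principal (H `` A)) (principal (H `` B))"
    if "A \<in> members F" "B \<in> members F" for A B
    using that by (intro bexI[of _ "A \<inter> B"]) (auto simp: members_def eventually_conj)
  ultimately show ?thesis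
    unfolding rel_image_def members_def[of "Inf _"]
    by (simp add: eventually_INF_base eventually_principal subset_iff Ball_def)
qed

text \<open>Meshing can be tested on a base, because enlarging one of two intersecting sets keeps
  them intersecting.\<close>

lemma mesh_rel_image_iff:
  "rel_image H F ## G \<longleftrightarrow> (\<forall>A \<in> members F. \<forall>B \<in> members G. H `` A \<inter> B \<noteq> {})"
proof
  assume "rel_image H F ## G"
  then show "\<forall>A \<in> members F. \<forall>B \<in> members G. H `` A \<inter> B \<noteq> {}"
    unfolding mesh_def by (meson members_rel_image order_refl)
next
  assume *: "\<forall>A \<in> members F. \<forall>B \<in> members G. H `` A \<inter> B \<noteq> {}"
  show "rel_image H F ## G"
    unfolding mesh_def
  proof (intro ballI)
    fix A' B
    assume "A' \<in> members (rel_image H F)" "B \<in> members G"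
    then obtain A where "A \<in> members F" "H `` A \<subseteq> A'"
      unfolding members_rel_image by (elim bexE)
    then have "H `` A \<inter> B \<subseteq> A' \<inter> B"
      by (intro Int_mono order_refl)
    moreover have "H `` A \<inter> B \<noteq> {}"
      by (rule *[rule_format]) fact+
    ultimately show "A' \<inter> B \<noteq> {}"
      by force
  qed
qed

text \<open>On sets, both sides ask for a pair of \<open>H\<close> in \<open>A \<times> B\<close>.
  This is the device that carries meshing back and forth along the graph of a map.\<close>

lemma mesh_rel_image_converse: "rel_image H F ## G \<longleftrightarrow> F ## rel_image (H\<inverse>) G"
proof -
  have "H `` A \<inter> B = {} \<longleftrightarrow> H\<inverse> `` B \<inter> A = {}" for A B
    by auto
  then have "rel_image H F ## G \<longleftrightarrow> rel_image (H\<inverse>) G ## F"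
    unfolding mesh_rel_image_iff by metis
  then show ?thesis
    using mesh_sym by metis
qed

lemma rel_image_filters_on: "H \<subseteq> X \<times> Y \<Longrightarrow> rel_image H F \<in> filters_on Y"
proof -
  assume "H \<subseteq> X \<times> Y"
  then have "Y \<in> members (rel_image H F)"
    unfolding members_rel_image by (intro bexI[of _ UNIV]) (auto simp: members_def)
  then show ?thesis
    by (simp add: members_def filters_on_def le_principal)
qed

text \<open>The graph sees only points of \<open>X\<close>, whereas \<open>filtermap\<close> uses
  \<open>f\<close> everywhere; the two agree because \<open>X\<close> belongs to
  \<open>F\<close>.\<close>

lemma rel_image_map_graph:
  assumes "F \<in> filters_on X"
  shows "rel_image (map_graph X f) F = filtermap f F"
proof -
  have X: "eventually (\<lambda>x. x \<in> X) F"
    using assms by (simp add: filters_on_def le_principal)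
  have "B \<in> members (rel_image (map_graph X f) F) \<longleftrightarrow> eventually (\<lambda>x. f x \<in> B) F" for B
  proof
    assume "B \<in> members (rel_image (map_graph X f) F)"
    then obtain A where "eventually (\<lambda>x. x \<in> A) F" "map_graph X f `` A \<subseteq> B"
      unfolding members_rel_image by (auto simp: members_def)
    from X this(1) show "eventually (\<lambda>x. f x \<in> B) F"
    proof eventually_elim
      case (elim x)
      then have "f x \<in> map_graph X f `` A"
        by (auto simp: map_graph_def)
      with \<open>map_graph X f `` A \<subseteq> B\<close> show ?case by blast
    qed
  next
    assume "eventually (\<lambda>x. f x \<in> B) F"
    then show "B \<in> members (rel_image (map_graph X f) F)"
      unfolding members_rel_image
      by (intro bexI[of _ "f -` B"]) (auto simp: members_def map_graph_def)
  qed
  \<comment> \<open>Taking \<open>B\<close> to be the set of points satisfying a predicate turns the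
    statement about members into equality of filters.\<close>
  from this[of "Collect _"] show ?thesis
    by (simp add: members_def filter_eq_iff eventually_filtermap)
qed

text \<open>This makes compactness the instance of \<open>\<D>\<close>-compactness for the class of
  all filters, so that one lemma yields both relations from continuity.\<close>

lemma F1_composable_filters_on: "F1_composable filters_on"
  by (auto simp: F1_composable_def intro: rel_image_filters_on)

lemma compact_relation_if_continuous:
  fixes X Y :: "'a set"
  assumes \<D>: "F1_composable \<D>" and f: "f \<in> X \<rightarrow> Y"
    and conv: "convergence_space Y \<tau>"
    and cont: "conv_continuous X \<xi> \<tau> f"
  shows "compact_relation \<D> X \<xi> Y \<tau> (map_graph X f)"
  unfolding compact_relation_def compact_at_def[of _ Y]
proof (intro allI ballI impI)
  let ?R = "map_graph X f"
  fix A F D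
  assume A: "A \<subseteq> X" and F: "F \<in> filters_on X" and comp: "compact_at \<D> X \<xi> F A"
    and D: "D \<in> \<D> Y" and mesh: "D ## rel_image ?R F"
  have "?R\<inverse> \<subseteq> Y \<times> X"
    using f by (auto simp: map_graph_def)
  then have "rel_image (?R\<inverse>) D \<in> \<D> X"
    using \<D> D unfolding F1_composable_def by blast
  moreover have "rel_image (?R\<inverse>) D ## F"
    using mesh by (simp add: mesh_rel_image_converse)
  ultimately obtain x where x: "x \<in> A" "x \<in> adh X \<xi> (rel_image (?R\<inverse>) D)"
    using comp unfolding compact_at_def by blast
  then obtain G where G: "G \<in> proper_filters_on X" "G ## rel_image (?R\<inverse>) D"
      "x \<in> conv_lim \<xi> G"
    by (auto simp: adh_def)
  have "filtermap f G ## D"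
    using G by (simp add: mesh_rel_image_converse[symmetric] rel_image_map_graph
        proper_filters_on_def)
  moreover have lim: "f x \<in> conv_lim \<tau> (filtermap f G)"
    using cont G by (auto simp: conv_continuous_def)
  \<comment> \<open>A convergence on \<open>Y\<close> relates only proper filters on
    \<open>Y\<close> to points, so having a limit is enough.\<close>
  moreover have "filtermap f G \<in> proper_filters_on Y"
    using conv lim by (auto simp: convergence_space_def conv_lim_def)
  ultimately have "f x \<in> adh Y \<tau> D"
    by (auto simp: adh_def)
  moreover have "f x \<in> ?R `` A"
    using x A by (auto simp: map_graph_def)
  ultimately show "adh Y \<tau> D \<inter> ?R `` A \<noteq> {}"
    by blast
qed

text \<open>If \<open>D\<close> meshes with \<open>F\<close>, then \<open>F\<close> itself witnesses
  that its limit \<open>x\<close> is an adherence point of \<open>D\<close>.\<close>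

lemma compact_at_limit:
  assumes "F \<in> proper_filters_on X" "x \<in> conv_lim \<xi> F"
  shows "compact_at \<D> X \<xi> F {x}"
  using assms by (auto simp: compact_at_def adh_def mesh_sym)

text \<open>The conclusion keeps \<open>Adh\<close> of the class at hand, so that it can be applied
  to \<open>\<D>\<close> and to the class of all filters before comparing with
  \<open>\<tau>\<close>.\<close>

lemma continuous_Adh_if_compact_relation:
  fixes X Y :: "'a set"
  assumes f: "f \<in> X \<rightarrow> Y" and conv: "convergence_space X \<xi>"
    and comp: "compact_relation \<D> X \<xi> Y \<tau> (map_graph X f)"
  shows "conv_continuous X \<xi> (Adh \<D> Y \<tau>) f"
  unfolding conv_continuous_def
proof (intro ballI subsetI, elim imageE)
  fix F x y
  assume F: "F \<in> proper_filters_on X" and x: "x \<in> conv_lim \<xi> F" and y: "y = f x"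
  have FX: "F \<in> filters_on X"
    using F by (simp add: proper_filters_on_def)
  have xX: "x \<in> X"
    using conv x by (auto simp: convergence_space_def conv_lim_def)
  have "map_graph X f \<subseteq> X \<times> Y"
    using f by (auto simp: map_graph_def)
  from rel_image_filters_on[OF this, of F] have "filtermap f F \<in> filters_on Y"
    by (simp add: rel_image_map_graph[OF FX])
  then have proper: "filtermap f F \<in> proper_filters_on Y"
    using F by (simp add: proper_filters_on_def filtermap_bot_iff)
  \<comment> \<open>This rests on \<open>x \<in> X\<close>; outside \<open>X\<close> the graph has
    no value and the image would be empty.\<close>
  have "map_graph X f `` {x} = {f x}"
    using xX by (auto simp: map_graph_def)
  moreover have "compact_at \<D> Y \<tau> (rel_image (map_graph X f) F) (map_graph X f `` {x})"
    using comp xX FX compact_at_limit[OF F x, of \<D>] by (simp add: compact_relation_def)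
  ultimately have "compact_at \<D> Y \<tau> (filtermap f F) {f x}"
    by (simp add: rel_image_map_graph[OF FX])
  then show "y \<in> conv_lim (Adh \<D> Y \<tau>) (filtermap f F)"
    using proper f xX y by (auto simp: compact_at_def conv_lim_def Adh_def)
qed

text \<open>A larger class imposes more adherence conditions on a limit point.\<close>

lemma Adh_antimono: "\<D> X \<subseteq> \<E> X \<Longrightarrow> Adh \<E> X \<xi> \<subseteq> Adh \<D> X \<xi>"
  by (auto simp: Adh_def)

lemma conv_continuous_mono:
  "conv_continuous X \<xi> \<sigma> f \<Longrightarrow> \<sigma> \<subseteq> \<tau> \<Longrightarrow> conv_continuous X \<xi> \<tau> f"
  unfolding conv_continuous_def conv_lim_def by blast

theorem corollary8:
  fixes \<D> :: "'a set \<Rightarrow> 'a filter set"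
    and X Y :: "'a set"
    and \<xi> \<tau> :: "'a convergence"
    and f :: "'a \<Rightarrow> 'a"
  assumes "filter_class \<D>"
    and "F1_composable \<D>"
    and "convergence_space X \<xi>"
    and "convergence_space Y \<tau>"
    and "\<tau> = Adh \<D> Y \<tau>"
    and "f \<in> X \<rightarrow> Y"
  shows "(conv_continuous X \<xi> \<tau> f \<longleftrightarrow> compact_relation filters_on X \<xi> Y \<tau> (map_graph X f))
       \<and> (conv_continuous X \<xi> \<tau> f \<longleftrightarrow> compact_relation \<D> X \<xi> Y \<tau> (map_graph X f))"
proof -
  \<comment> \<open>Used with \<open>\<E>\<close> equal to \<open>\<D>\<close> and to
    \<open>filters_on\<close>, this gives both implications back to continuity.\<close>
  have continuous: "conv_continuous X \<xi> \<tau> f"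
    if "compact_relation \<E> X \<xi> Y \<tau> (map_graph X f)" "\<D> Y \<subseteq> \<E> Y" for \<E>
  proof (rule conv_continuous_mono)
    show "conv_continuous X \<xi> (Adh \<E> Y \<tau>) f"
      using continuous_Adh_if_compact_relation[OF assms(6,3) that(1)] .
    show "Adh \<E> Y \<tau> \<subseteq> \<tau>"
      \<comment> \<open>Only the \<open>\<tau>\<close> on the right is replaced by
        \<open>Adh \<D> Y \<tau>\<close>, which leaves a comparison of two classes over the same
        \<open>\<tau>\<close>.\<close>
      by (subst (2) assms(5)) (rule Adh_antimono[of \<D> Y \<E>, OF that(2)])
  qed
  have sub: "\<D> Y \<subseteq> filters_on Y"
    using assms(1) by (simp add: filter_class_def)
  have "compact_relation filters_on X \<xi> Y \<tau> (map_graph X f)"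
      "compact_relation \<D> X \<xi> Y \<tau> (map_graph X f)"
    if "conv_continuous X \<xi> \<tau> f"
    using compact_relation_if_continuous[OF F1_composable_filters_on assms(6,4) that]
      compact_relation_if_continuous[OF assms(2,6,4) that] by simp_all
  then show ?thesis
    using continuous[of filters_on] continuous[of \<D>] sub by blast
qed

end
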